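(* Let $(\Phi,\mathfrak N,\mathfrak T,\mathfrak R,\mathfrak S,\phi_{\mathrm{start}},\Sigma,\mathrm{Lex},\mathrm{Sel})$ be a parameterized local lexing, $D\in\Sigma^*$, $0\le k\le|D|$ and $T$ a set of parameterized tokens. Then $\pi_k\,T$ simulates $\pi'_k\,\mathcal U(T)$: for every set $I$ of parameterized items and every set $I'$ of ordinary items of the induced grammar, $I\sim I'$ implies $\pi_k\,T\,I\sim\pi'_k\,\mathcal U(T)\,I'$.
   Context: $\Phi$ is a non-empty set; $\mathfrak N,\mathfrak T$ disjoint sets of nonterminals and terminals; $\mathfrak S\in\mathfrak N$, $\phi_{\mathrm{start}}\in\Phi$; $\mathfrak R$ a set of parameterized rules $N_{f_{k+1}}\to X_1^{f_1}\cdots X_k^{f_k}$ ($k\ge0$, $N\in\mathfrak N$, $X_i\in\mathfrak N\cup\mathfrak T$, partial $f_i:\Phi^{2i-1}\rightharpoonup\Phi$); $\Sigma$ a set of characters; $\mathrm{Lex},\mathrm{Sel}$ not needed here. A parameterized token is an element $(t,\alpha,\beta,c)$ of $\mathfrak T\times\Phi\times\Phi\times\Sigma^*$ (with $k+|c|\le|D|$). Sequences indexed from 0; juxtaposition is concatenation; $\mathrm{take}_n$ takes the first $n$ entries. $\langle f_1,\dots,f_u\rangle$ is the set of $\rho\in\Phi^{2u}$ with $f_i$ defined at $(\rho_0,\dots,\rho_{2i-2})$ and $\rho_{2i-1}=f_i(\rho_0,\dots,\rho_{2i-2})$ for $i=1,\dots,u$. Induced grammar: nonterminals $(\mathfrak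 N\times\Phi\times\Phi)\cup\{\top,\bot\}$, terminals $\overline{\mathfrak T}=\mathfrak T\times\Phi\times\Phi$, triples written $X^\alpha_\beta$; rules $\overline{\mathfrak R}=\{\top\to\mathfrak S^{\phi_{\mathrm{start}}}_\beta\mid\beta\in\Phi\}\cup\bigcup_{r\in\mathfrak R}\overline r$, where for $r=N_{f_{k+1}}\to X_1^{f_1}\cdots X_k^{f_k}$, $\overline r$ consists of (i) rules $N^\alpha_\beta\to(X_1)^{\alpha_1}_{\beta_1}\cdots(X_k)^{\alpha_k}_{\beta_k}$ with $(\alpha,\alpha_1,\beta_1,\dots,\alpha_k,\beta_k,\beta)\in\langle f_1,\dots,f_{k+1}\rangle$, and (ii) rules $N^\alpha_\beta\to(X_1)^{\alpha_1}_{\beta_1}\cdots(X_h)^{\alpha_h}_{\beta_h}\bot$ with $1\le h\le k$, $\beta,\beta_h\in\Phi$, $(\alpha,\alpha_1,\beta_1,\dots,\alpha_h)\in\langle f_1,\dots,f_h\rangle$ and $f_{h+1}$ undefined at $(\alpha,\alpha_1,\beta_1,\dots,\alpha_h,\beta_h)$. $\mathcal U(t,\alpha,\beta,c)=(t^\alpha_\beta,c)$, lifted to sets. Items: parameterized item $(r,d,i,j,\rho)$ with $r=N_{f_{v+1}}\to X_1^{f_1}\cdots X_v^{f_v}\in\mathfrak R$, $0\le d\le v$, $0\le i\le j\le|D|$, $\rho\in\langle f_1,\dots,f_{d+1}\rangle$. Ordinary item $(q,d,i,j)$ with $q=(L\to w)\in\overline{\mathfrak R}$, $0\le d\le|w|$,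 $0\le i\le j\le|D|$, written $(L\to w_1\bullet w_2,i,j)$, $|w_1|=d$. For $x=(r,d,i,j,\rho)$, $\overline x$ consists of all $(q,d,i,j)$ with $q\in\overline r$ of type (i) and $\mathrm{take}_{2(d+1)}(\alpha,\alpha_1,\beta_1,\dots,\alpha_k,\beta_k,\beta)=\rho$, and all $(q,d,i,j)$ with $q\in\overline r$ of type (ii), $d\le h-1$, $\mathrm{take}_{2(d+1)}(\alpha,\alpha_1,\beta_1,\dots,\alpha_h)=\rho$. $\overline I=\bigcup_{x\in I}\overline x$; $\mathrm{Norm}(I')=\{(L\to w_1\bullet w_2,i,j)\in I'\mid L\ne\top,\ w_2\text{ is not the one-symbol string }\bot\}$; $I\sim I'$ means $\overline I=\mathrm{Norm}(I')$. PELLA steps ($r=N_{f_{v+1}}\to X_1^{f_1}\cdots X_v^{f_v}$ throughout): $\mathrm{Predict}\,k\,I=I\cup\{(r',0,k,k,(\rho_{2d+1},g_1(\rho_{2d+1})))\mid(r,d,i,k,\rho)\in I,d<v,X_{d+1}=M,\ r'=M_{g_{u+1}}\to Y_1^{g_1}\cdots Y_u^{g_u}\in\mathfrak R,\ g_1\text{ defined at }\rho_{2d+1}\}$; $\mathrm{Complete}\,k\,I=I\cup\{(r,d+1,i,k,\rho'\,f_{d+2}(\rho'))\mid(r,d,i,j,\rho)\in I,d<v,X_{d+1}=M,\ (r',u,j,k,\xi)\in I\text{ with }r'=M_{g_{u+1}}\to Y_1^{g_1}\cdots Y_u^{g_u},\ \rho_{2d+1}=\xi_0,\ \rho'=\rho\,\xi_{2u+1},\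 f_{d+2}\text{ defined at }\rho'\}$; $\mathrm{Scan}\,T\,k\,I=I\cup\{(r,d+1,i,k+|c|,\rho'\,f_{d+2}(\rho'))\mid(r,d,i,k,\rho)\in I,d<v,(X_{d+1},\rho_{2d+1},\beta,c)\in T,\rho'=\rho\,\beta,f_{d+2}\text{ defined at }\rho'\}$. ELLA steps: $\mathrm{Predict}'\,k\,I'=I'\cup\{(M\to\bullet w,k,k)\mid(L\to a\bullet M\,b,i,k)\in I',(M\to w)\in\overline{\mathfrak R}\}$; $\mathrm{Complete}'\,k\,I'=I'\cup\{(L\to a\,M\bullet b,i,k)\mid(L\to a\bullet M\,b,i,j)\in I',(M\to w\bullet,j,k)\in I'\}$; $\mathrm{Scan}'\,T'\,k\,I'=I'\cup\{(L\to a\,t\bullet b,i,k+|c|)\mid(L\to a\bullet t\,b,i,k)\in I',(t,c)\in T'\}$. With $\mathrm{limit}\,f\,X=\bigcup_{n\ge0}f^n(X)$: $\pi_k\,T\,I=\mathrm{limit}(\mathrm{Scan}\,T\,k\circ\mathrm{Complete}\,k\circ\mathrm{Predict}\,k)\,I$ and $\pi'_k\,T'\,I'=\mathrm{limit}(\mathrm{Scan}'\,T'\,k\circ\mathrm{Complete}'\,k\circ\mathrm{Predict}'\,k)\,I'$.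
   Formalization: Added hypothesis: every item that Predict' k derives from the items of I' with left-hand side ⊤ is already in I'. Without it the claim fails, e.g. for I = ∅, I' = {(⊤ → •S, 0, 0)}, k = 0 and a single rule S → ε. *)

theory Defs
  imports Main
begin

text \<open>
  A rule with left-hand side N, right-hand side \<open>X\<^sub>1 \<dots> X\<^sub>k\<close> and parameter functions
  \<open>f\<^sub>1, \<dots>, f\<^sub>k\<^sub>+\<^sub>1\<close>. Tuples of parameters are lists, so \<open>f\<^sub>i\<close> is \<open>pfuns r ! (i - 1)\<close>, a partial
  function that is required below to be defined only on lists of length \<open>2 * i - 1\<close>.
\<close>

datatype ('p, 's) prule =
  PRule (plhs: 's) (prhs: "'s list") (pfuns: "('p list \<Rightarrow> 'p option) list")

record ('p, 's, 'c) pgrammar =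
  params :: "'p set"
  nonterms :: "'s set"
  terms :: "'s set"
  prules :: "('p, 's) prule set"
  start :: 's
  start_param :: 'p
  chars :: "'c set"

definition wf_prule :: "('p, 's, 'c) pgrammar \<Rightarrow> ('p, 's) prule \<Rightarrow> bool" where
  "wf_prule G r \<longleftrightarrow>
     plhs r \<in> nonterms G \<and>
     set (prhs r) \<subseteq> nonterms G \<union> terms G \<and>
     length (pfuns r) = length (prhs r) + 1 \<and>
     (\<forall>i < length (pfuns r).
        dom (pfuns r ! i) \<subseteq> {xs. length xs = 2 * i + 1 \<and> set xs \<subseteq> params G} \<and>
        ran (pfuns r ! i) \<subseteq> params G)"

text \<open>
  The components Lex and Sel of a parameterized local lexing are omitted: neither the induced
  grammar nor the operators below refer to them.
\<close>

definition parameterized_local_lexing :: "('p, 's, 'c) pgrammar \<Rightarrow> bool" where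
  "parameterized_local_lexing G \<longleftrightarrow>
     params G \<noteq> {} \<and>
     nonterms G \<inter> terms G = {} \<and>
     start G \<in> nonterms G \<and>
     start_param G \<in> params G \<and>
     (\<forall>r \<in> prules G. wf_prule G r)"

definition angle :: "('p, 's, 'c) pgrammar \<Rightarrow> ('p list \<Rightarrow> 'p option) list \<Rightarrow> 'p list set" where
  "angle G fs =
     {\<rho>. length \<rho> = 2 * length fs \<and> set \<rho> \<subseteq> params G \<and>
         (\<forall>i < length fs. (fs ! i) (take (2 * i + 1) \<rho>) = Some (\<rho> ! (2 * i + 1)))}"


text \<open>
  \<open>Par X \<alpha> \<beta>\<close> is \<open>X\<close> with superscript \<open>\<alpha>\<close> and subscript \<open>\<beta>\<close>; it is a nonterminal or a terminal
  of the induced grammar according to whether \<open>X\<close> is a nonterminal or a terminal.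
\<close>

datatype ('p, 's) isym = Par 's 'p 'p | Top | Bot

type_synonym ('p, 's) irule = "('p, 's) isym \<times> ('p, 's) isym list"

text \<open>
  For \<open>\<sigma> = (\<alpha>, \<alpha>\<^sub>1, \<beta>\<^sub>1, \<alpha>\<^sub>2, \<beta>\<^sub>2, \<dots>)\<close> this is the string of the first \<open>n\<close> symbols of the
  right-hand side of \<open>r\<close>, the \<open>i\<close>-th one carrying \<open>\<alpha>\<^sub>i\<close> and \<open>\<beta>\<^sub>i\<close>.
\<close>

definition psyms :: "('p, 's) prule \<Rightarrow> 'p list \<Rightarrow> nat \<Rightarrow> ('p, 's) isym list" where
  "psyms r \<sigma> n = map (\<lambda>m. Par (prhs r ! m) (\<sigma> ! (2 * m + 1)) (\<sigma> ! (2 * m + 2))) [0..<n]"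

definition params_i :: "('p, 's, 'c) pgrammar \<Rightarrow> ('p, 's) prule \<Rightarrow> 'p list set" where
  "params_i G r = angle G (pfuns r)"

definition rule_i :: "('p, 's) prule \<Rightarrow> 'p list \<Rightarrow> ('p, 's) irule" where
  "rule_i r \<sigma> =
     (Par (plhs r) (\<sigma> ! 0) (\<sigma> ! (2 * length (prhs r) + 1)), psyms r \<sigma> (length (prhs r)))"

text \<open>
  In a quadruple \<open>(h, \<sigma>, b, \<beta>)\<close>, \<open>\<sigma>\<close> is \<open>(\<alpha>, \<alpha>\<^sub>1, \<beta>\<^sub>1, \<dots>, \<alpha>\<^sub>h)\<close>, \<open>b\<close> is \<open>\<beta>\<^sub>h\<close> and \<open>\<beta>\<close> is the
  subscript of the left-hand side.
\<close>

definition params_ii ::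
    "('p, 's, 'c) pgrammar \<Rightarrow> ('p, 's) prule \<Rightarrow> (nat \<times> 'p list \<times> 'p \<times> 'p) set" where
  "params_ii G r =
     {(h, \<sigma>, b, \<beta>). 1 \<le> h \<and> h \<le> length (prhs r) \<and> b \<in> params G \<and> \<beta> \<in> params G \<and>
        \<sigma> \<in> angle G (take h (pfuns r)) \<and> (pfuns r ! h) (\<sigma> @ [b]) = None}"

definition rule_ii :: "('p, 's) prule \<Rightarrow> nat \<Rightarrow> 'p list \<Rightarrow> 'p \<Rightarrow> 'p \<Rightarrow> ('p, 's) irule" where
  "rule_ii r h \<sigma> b \<beta> = (Par (plhs r) (\<sigma> ! 0) \<beta>, psyms r (\<sigma> @ [b]) h @ [Bot])"

definition induced :: "('p, 's, 'c) pgrammar \<Rightarrow> ('p, 's) prule \<Rightarrow> ('p, 's) irule set" where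
  "induced G r =
     {rule_i r \<sigma> | \<sigma>. \<sigma> \<in> params_i G r} \<union>
     {rule_ii r h \<sigma> b \<beta> | h \<sigma> b \<beta>. (h, \<sigma>, b, \<beta>) \<in> params_ii G r}"

definition irules :: "('p, 's, 'c) pgrammar \<Rightarrow> ('p, 's) irule set" where
  "irules G =
     {(Top, [Par (start G) (start_param G) \<beta>]) | \<beta>. \<beta> \<in> params G} \<union>
     (\<Union>r \<in> prules G. induced G r)"


type_synonym ('p, 's, 'c) ptoken = "'s \<times> 'p \<times> 'p \<times> 'c list"
type_synonym ('p, 's) pitem = "('p, 's) prule \<times> nat \<times> nat \<times> nat \<times> 'p list"
type_synonym ('p, 's) oitem = "('p, 's) irule \<times> nat \<times> nat \<times> nat"

definition ptokens :: "('p, 's, 'c) pgrammar \<Rightarrow> 'c list \<Rightarrow> nat \<Rightarrow> ('p, 's, 'c) ptoken set" where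
  "ptokens G D k =
     {(t, \<alpha>, \<beta>, c). t \<in> terms G \<and> \<alpha> \<in> params G \<and> \<beta> \<in> params G \<and> c \<in> lists (chars G) \<and>
        k + length c \<le> length D}"

definition unparam :: "('p, 's, 'c) ptoken set \<Rightarrow> (('p, 's) isym \<times> 'c list) set" where
  "unparam T = (\<lambda>(t, \<alpha>, \<beta>, c). (Par t \<alpha> \<beta>, c)) ` T"

definition pitems :: "('p, 's, 'c) pgrammar \<Rightarrow> 'c list \<Rightarrow> ('p, 's) pitem set" where
  "pitems G D =
     {(r, d, i, j, \<rho>). r \<in> prules G \<and> d \<le> length (prhs r) \<and> i \<le> j \<and> j \<le> length D \<and>
        \<rho> \<in> angle G (take (d + 1) (pfuns r))}"

text \<open>The ordinary item \<open>(L \<rightarrow> w\<^sub>1 \<bullet> w\<^sub>2, i, j)\<close> is \<open>((L, w\<^sub>1 @ w\<^sub>2), length w\<^sub>1, i, j)\<close>.\<close>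

definition oitems :: "('p, 's, 'c) pgrammar \<Rightarrow> 'c list \<Rightarrow> ('p, 's) oitem set" where
  "oitems G D =
     {((L, w), d, i, j). (L, w) \<in> irules G \<and> d \<le> length w \<and> i \<le> j \<and> j \<le> length D}"

fun overline :: "('p, 's, 'c) pgrammar \<Rightarrow> ('p, 's) pitem \<Rightarrow> ('p, 's) oitem set" where
  "overline G (r, d, i, j, \<rho>) =
     {(rule_i r \<sigma>, d, i, j) | \<sigma>. \<sigma> \<in> params_i G r \<and> take (2 * (d + 1)) \<sigma> = \<rho>} \<union>
     {(rule_ii r h \<sigma> b \<beta>, d, i, j) | h \<sigma> b \<beta>.
        (h, \<sigma>, b, \<beta>) \<in> params_ii G r \<and> d + 1 \<le> h \<and> take (2 * (d + 1)) \<sigma> = \<rho>}"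

definition norm_items :: "('p, 's) oitem set \<Rightarrow> ('p, 's) oitem set" where
  "norm_items I' = {((L, w), d, i, j). ((L, w), d, i, j) \<in> I' \<and> L \<noteq> Top \<and> drop d w \<noteq> [Bot]}"

definition sim :: "('p, 's, 'c) pgrammar \<Rightarrow> ('p, 's) pitem set \<Rightarrow> ('p, 's) oitem set \<Rightarrow> bool" where
  "sim G I I' \<longleftrightarrow> (\<Union>x \<in> I. overline G x) = norm_items I'"


definition predict :: "('p, 's, 'c) pgrammar \<Rightarrow> nat \<Rightarrow> ('p, 's) pitem set \<Rightarrow> ('p, 's) pitem set" where
  "predict G k I = I \<union>
     {(r', 0, k, k, [\<rho> ! (2 * d + 1), a]) | r' r d i \<rho> a.
        (r, d, i, k, \<rho>) \<in> I \<and> d < length (prhs r) \<and> r' \<in> prules G \<and> prhs r ! d = plhs r' \<and>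
        (pfuns r' ! 0) [\<rho> ! (2 * d + 1)] = Some a}"

definition complete :: "nat \<Rightarrow> ('p, 's) pitem set \<Rightarrow> ('p, 's) pitem set" where
  "complete k I = I \<union>
     {(r, d + 1, i, k, \<rho>' @ [a]) | r d i j \<rho> r' \<xi> \<rho>' a.
        (r, d, i, j, \<rho>) \<in> I \<and> d < length (prhs r) \<and> prhs r ! d = plhs r' \<and>
        (r', length (prhs r'), j, k, \<xi>) \<in> I \<and> \<rho> ! (2 * d + 1) = \<xi> ! 0 \<and>
        \<rho>' = \<rho> @ [\<xi> ! (2 * length (prhs r') + 1)] \<and>
        (pfuns r ! (d + 1)) \<rho>' = Some a}"

definition scan ::
    "('p, 's, 'c) ptoken set \<Rightarrow> nat \<Rightarrow> ('p, 's) pitem set \<Rightarrow> ('p, 's) pitem set" where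
  "scan T k I = I \<union>
     {(r, d + 1, i, k + length c, \<rho>' @ [a]) | r d i \<rho> \<beta> c \<rho>' a.
        (r, d, i, k, \<rho>) \<in> I \<and> d < length (prhs r) \<and> (prhs r ! d, \<rho> ! (2 * d + 1), \<beta>, c) \<in> T \<and>
        \<rho>' = \<rho> @ [\<beta>] \<and> (pfuns r ! (d + 1)) \<rho>' = Some a}"

definition predict' ::
    "('p, 's, 'c) pgrammar \<Rightarrow> nat \<Rightarrow> ('p, 's) oitem set \<Rightarrow> ('p, 's) oitem set" where
  "predict' G k I' = I' \<union>
     {((M, w), 0, k, k) | M w L a b i.
        ((L, a @ M # b), length a, i, k) \<in> I' \<and> (M, w) \<in> irules G}"

definition complete' :: "nat \<Rightarrow> ('p, 's) oitem set \<Rightarrow> ('p, 's) oitem set" where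
  "complete' k I' = I' \<union>
     {((L, a @ M # b), length a + 1, i, k) | L a M b i j w.
        ((L, a @ M # b), length a, i, j) \<in> I' \<and> ((M, w), length w, j, k) \<in> I'}"

definition scan' ::
    "(('p, 's) isym \<times> 'c list) set \<Rightarrow> nat \<Rightarrow> ('p, 's) oitem set \<Rightarrow> ('p, 's) oitem set" where
  "scan' T' k I' = I' \<union>
     {((L, a @ t # b), length a + 1, i, k + length c) | L a t b i c.
        ((L, a @ t # b), length a, i, k) \<in> I' \<and> (t, c) \<in> T'}"

definition limit :: "('a set \<Rightarrow> 'a set) \<Rightarrow> 'a set \<Rightarrow> 'a set" where
  "limit f X = (\<Union>n. (f ^^ n) X)"

definition pella ::
    "('p, 's, 'c) pgrammar \<Rightarrow> nat \<Rightarrow> ('p, 's, 'c) ptoken set \<Rightarrow>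
     ('p, 's) pitem set \<Rightarrow> ('p, 's) pitem set" where
  "pella G k T = limit (scan T k \<circ> complete k \<circ> predict G k)"

definition ella ::
    "('p, 's, 'c) pgrammar \<Rightarrow> nat \<Rightarrow> (('p, 's) isym \<times> 'c list) set \<Rightarrow>
     ('p, 's) oitem set \<Rightarrow> ('p, 's) oitem set" where
  "ella G k T' = limit (scan' T' k \<circ> complete' k \<circ> predict' G k)"


definition top_items :: "('p, 's) oitem set \<Rightarrow> ('p, 's) oitem set" where
  "top_items I' = {((L, w), d, i, j). ((L, w), d, i, j) \<in> I' \<and> L = Top}"

text \<open>
  \<open>norm_items\<close> discards the items with left-hand side \<open>\<top>\<close>, so \<open>sim\<close> does not see them, but
  \<open>predict'\<close> acts on them. Hence \<open>sim\<close> is preserved only if the items that \<open>predict'\<close> derives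
  from \<open>top_items I'\<close> are already in \<open>I'\<close>; without this, a lone item \<open>\<top> \<rightarrow> \<bullet> \<SS>\<close> is a
  counterexample.
\<close>

lemma sim_not_preserved_without_top_closure:
  "\<exists>(G :: (unit, unit, unit) pgrammar) D k T I I'.
     parameterized_local_lexing G \<and> D \<in> lists (chars G) \<and> k \<le> length D \<and>
     T \<subseteq> ptokens G D k \<and> I \<subseteq> pitems G D \<and> I' \<subseteq> oitems G D \<and>
     sim G I I' \<and> \<not> sim G (pella G k T I) (ella G k (unparam T) I')"
proof -
  define r :: "(unit, unit) prule" where "r = PRule () [] [[[()] \<mapsto> ()]]"
  define G :: "(unit, unit, unit) pgrammar" where
    "G = \<lparr>params = UNIV, nonterms = UNIV, terms = {}, prules = {r}, start = (),
          start_param = (), chars = {}\<rparr>"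
  define I' :: "(unit, unit) oitem set" where "I' = {((Top, [Par () () ()]), 0, 0, 0)}"
  define T :: "(unit, unit, unit) ptoken set" where "T = {}"
  let ?f = "scan T 0 \<circ> complete 0 \<circ> predict G 0"
  let ?f' = "scan' (unparam T) 0 \<circ> complete' 0 \<circ> predict' G 0"
  let ?x = "((Par () () (), []), 0, 0, 0) :: (unit, unit) oitem"
  have wf: "parameterized_local_lexing G"
    by (auto simp: parameterized_local_lexing_def wf_prule_def G_def r_def)
  have I': "I' \<subseteq> oitems G []"
    by (auto simp: I'_def oitems_def irules_def G_def)
  have sim: "sim G {} I'"
    by (auto simp: sim_def norm_items_def I'_def)
  have "[(), ()] \<in> params_i G r"
    by (simp add: params_i_def angle_def r_def G_def)
  moreover have "rule_i r [(), ()] = (Par () () (), [])"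
    by (simp add: rule_i_def psyms_def r_def)
  ultimately have "(Par () () (), []) \<in> induced G r"
    unfolding induced_def by force
  then have rule: "(Par () () (), []) \<in> irules G"
    by (auto simp: irules_def G_def)
  have "((Top, [] @ Par () () () # []), length [], 0, 0) \<in> I'"
    by (simp add: I'_def)
  with rule have "?x \<in> predict' G 0 I'"
    unfolding predict'_def by blast
  then have "?x \<in> (?f' ^^ 1) I'"
    by (simp add: scan'_def complete'_def)
  then have "?x \<in> ella G 0 (unparam T) I'"
    unfolding ella_def limit_def by blast
  then have x: "?x \<in> norm_items (ella G 0 (unparam T) I')"
    by (simp add: norm_items_def)
  have "?f {} = {}"
    by (simp add: scan_def complete_def predict_def)
  then have "(?f ^^ n) {} = {}" for n
    by (induction n) auto
  then have "pella G 0 T {} = {}"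
    unfolding pella_def limit_def by blast
  with x have "\<not> sim G (pella G 0 T {}) (ella G 0 (unparam T) I')"
    by (auto simp: sim_def)
  with wf I' sim show ?thesis
    by (intro exI[of _ G] exI[of _ "[]"] exI[of _ 0] exI[of _ T] exI[of _ "{}"] exI[of _ I'])
      (auto simp: T_def)
qed

end

theory Submission
  imports Defs
begin

text \<open>
  Each of the three steps preserves \<open>\<sim>\<close>, together with a closure property of the \<open>\<top>\<close>-items, and
  \<open>\<sim>\<close> passes to unions of chains. An ordinary item at dot position \<open>d\<close> only exposes the first
  \<open>2 * d + 2\<close> parameters of its rule, and advancing the dot exposes two more, unless the remaining
  string becomes \<open>\<bottom>\<close>; this is exactly what the parameterized steps compute. The rules of type (ii)
  are needed for prediction: a parameterized item predicts \<open>M\<^sup>\<alpha>\<^sub>\<beta>\<close> for every \<open>\<beta>\<close>, so for each \<open>\<beta>\<close>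
  there must be an ordinary item covered by it with \<open>M\<^sup>\<alpha>\<^sub>\<beta>\<close> behind the dot, even when the parameters
  cannot be completed to a rule of type (i).
\<close>

text \<open>
  \<open>expands G r \<tau> q\<close> treats the rules of both types uniformly: \<open>\<tau>\<close> is the list of all parameters that
  occur in \<open>q\<close>, except for the arbitrary subscript of the left-hand side in type (ii). Its length is
  even in type (i) and odd in type (ii).
\<close>

definition expands ::
    "('p, 's, 'c) pgrammar \<Rightarrow> ('p, 's) prule \<Rightarrow> 'p list \<Rightarrow> ('p, 's) irule \<Rightarrow> bool" where
  "expands G r \<tau> q \<longleftrightarrow>
     (\<tau> \<in> params_i G r \<and> q = rule_i r \<tau>) \<or>
     (\<exists>h \<sigma> b \<beta>. (h, \<sigma>, b, \<beta>) \<in> params_ii G r \<and> \<tau> = \<sigma> @ [b] \<and> q = rule_ii r h \<sigma> b \<beta>)"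

section \<open>Parameter lists and the induced rules they expand to\<close>

lemma length_psyms [simp]: "length (psyms r \<sigma> n) = n"
  by (simp add: psyms_def)

lemma nth_psyms [simp]:
  "m < n \<Longrightarrow> psyms r \<sigma> n ! m = Par (prhs r ! m) (\<sigma> ! (2 * m + 1)) (\<sigma> ! (2 * m + 2))"
  by (simp add: psyms_def)

lemma wf_prule_lengthD: "wf_prule G r \<Longrightarrow> length (pfuns r) = Suc (length (prhs r))"
  by (simp add: wf_prule_def)

lemma wf_prule_funD:
  assumes "wf_prule G r" "i \<le> length (prhs r)" "(pfuns r ! i) xs = Some a"
  shows "length xs = 2 * i + 1" "set xs \<subseteq> params G" "a \<in> params G"
proof -
  have "xs \<in> dom (pfuns r ! i)" "a \<in> ran (pfuns r ! i)"
    using assms(3) by (auto intro: ranI)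
  moreover have "i < length (pfuns r)"
    using assms(1,2) by (simp add: wf_prule_def)
  ultimately show "length xs = 2 * i + 1" "set xs \<subseteq> params G" "a \<in> params G"
    using assms(1) unfolding wf_prule_def by blast+
qed

text \<open>The old conditions read only prefixes inside \<open>\<rho>\<close>, so the one at index
  \<open>n\<close> is the only new one. That \<open>b\<close> and \<open>a\<close> are parameters
  follows from the domain and range conditions in \<open>wf_prule\<close>.\<close>

lemma angle_snoc:
  assumes "wf_prule G r" "n \<le> length (prhs r)" "\<rho> \<in> angle G (take n (pfuns r))"
    and "(pfuns r ! n) (\<rho> @ [b]) = Some a"
  shows "\<rho> @ [b] @ [a] \<in> angle G (take (Suc n) (pfuns r))"
proof -
  have len: "length \<rho> = 2 * n" "n < length (pfuns r)"
    using assms(1-3) by (auto simp: angle_def wf_prule_def)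
  have sub: "set \<rho> \<subseteq> params G"
    and funs: "(pfuns r ! i) (take (2 * i + 1) \<rho>) = Some (\<rho> ! (2 * i + 1))" if "i < n" for i
    using assms(3) len(2) that by (auto simp: angle_def)
  have "(pfuns r ! i) (take (2 * i + 1) (\<rho> @ [b] @ [a])) = Some ((\<rho> @ [b] @ [a]) ! (2 * i + 1))"
    if "i < Suc n" for i
  proof (cases "i = n")
    case True
    then show ?thesis
      using assms(4) len by (simp add: nth_append)
  next
    case False
    then have "i < n"
      using that by simp
    then show ?thesis
      using funs[of i] len by (simp add: nth_append)
  qed
  then show ?thesis
    using len wf_prule_funD[OF assms(1,2,4)] by (auto simp: angle_def)
qed

text \<open>\<open>length \<tau>\<close> is \<open>2 * length (prhs r) + 2\<close> in type (i) and
  \<open>2 * h + 1\<close> in type (ii), where \<open>Bot\<close> stands at position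
  \<open>h\<close>. All three claims are arithmetic on these values; an odd length signals the final
  \<open>Bot\<close>.\<close>

lemma expands_length:
  assumes "wf_prule G r" "expands G r \<tau> q"
  shows "2 * m + 2 < length \<tau> \<longleftrightarrow> m < length (snd q) \<and> snd q ! m \<noteq> Bot" (is ?sym)
    and "2 * d + 2 < length \<tau> \<Longrightarrow>
      2 * Suc d + 2 \<le> length \<tau> \<longleftrightarrow> drop (Suc d) (snd q) \<noteq> [Bot]" (is "_ \<Longrightarrow> ?step")
    and "2 * d + 2 \<le> length \<tau> \<Longrightarrow> drop d (snd q) \<noteq> [Bot]" (is "_ \<Longrightarrow> ?drop")
proof -
  note len = wf_prule_lengthD[OF assms(1)]
  consider (i) "length \<tau> = 2 * length (prhs r) + 2" "q = rule_i r \<tau>"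
    | (ii) h \<sigma> b \<beta> where "\<tau> = \<sigma> @ [b]" "length \<sigma> = 2 * h" "1 \<le> h" "q = rule_ii r h \<sigma> b \<beta>"
    using assms(2) len by (fastforce simp: expands_def params_i_def params_ii_def angle_def)
  note cases = this
  show ?sym
    using cases
    by cases (auto simp: rule_i_def rule_ii_def nth_append less_Suc_eq)
  have bot: "drop e (psyms r \<rho> n) \<noteq> [Bot]" for e \<rho> n
  proof
    assume *: "drop e (psyms r \<rho> n) = [Bot]"
    then have "length (drop e (psyms r \<rho> n)) = 1"
      by simp
    then have "e < n"
      by simp
    moreover have "drop e (psyms r \<rho> n) ! 0 = Bot"
      using * by simp
    ultimately show False
      by simp
  qed
  have bot': "drop e (psyms r \<rho> n @ [Bot]) = [Bot] \<longleftrightarrow> e = n" for e \<rho> n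
  proof
    assume *: "drop e (psyms r \<rho> n @ [Bot]) = [Bot]"
    then have "length (drop e (psyms r \<rho> n @ [Bot])) = 1"
      by simp
    then show "e = n"
      by simp
  qed simp
  show ?step if "2 * d + 2 < length \<tau>"
    using cases that by cases (auto simp: rule_i_def rule_ii_def bot bot' simp del: drop_append)
  show ?drop if "2 * d + 2 \<le> length \<tau>"
    using cases that by cases (auto simp: rule_i_def rule_ii_def bot bot' simp del: drop_append)
qed

lemma expands_nth:
  assumes "wf_prule G r" "expands G r \<tau> q" "2 * m + 2 < length \<tau>"
  shows "m < length (prhs r)"
    and "snd q ! m = Par (prhs r ! m) (\<tau> ! (2 * m + 1)) (\<tau> ! (2 * m + 2))"
  using assms wf_prule_lengthD[OF assms(1)]
  by (auto simp: expands_def params_i_def params_ii_def angle_def rule_i_def rule_ii_def nth_append)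

text \<open>In type (ii) the bound stops just below \<open>m = h\<close>, where the function is
  undefined.\<close>

lemma expands_fun:
  assumes "wf_prule G r" "expands G r \<tau> q" "2 * m + 1 < length \<tau>"
  shows "(pfuns r ! m) (take (2 * m + 1) \<tau>) = Some (\<tau> ! (2 * m + 1))"
  using assms wf_prule_lengthD[OF assms(1)]
  by (auto simp: expands_def params_i_def params_ii_def angle_def nth_append)

lemma expands_fst:
  assumes "wf_prule G r" "expands G r \<tau> q"
  obtains \<beta> where "fst q = Par (plhs r) (\<tau> ! 0) \<beta>" "\<beta> \<in> params G"
proof -
  note len = wf_prule_lengthD[OF assms(1)]
  from assms(2) consider (i) "\<tau> \<in> params_i G r" "q = rule_i r \<tau>"
    | (ii) h \<sigma> b \<beta> where "(h, \<sigma>, b, \<beta>) \<in> params_ii G r" "\<tau> = \<sigma> @ [b]" "q = rule_ii r h \<sigma> b \<beta>"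
    by (auto simp: expands_def)
  then show thesis
  proof cases
    case i
    then have "\<tau> ! (2 * length (prhs r) + 1) \<in> set \<tau>"
      using len by (intro nth_mem) (simp add: params_i_def angle_def)
    then show thesis
      using that i by (auto simp: rule_i_def params_i_def angle_def)
  next
    case ii
    then have "length \<sigma> = 2 * h" "1 \<le> h"
      using len by (auto simp: params_ii_def angle_def)
    then show thesis
      using that ii by (auto simp: rule_ii_def params_ii_def nth_append)
  qed
qed

lemma expands_length_ge:
  assumes "wf_prule G r" "expands G r \<tau> q"
  shows "2 \<le> length \<tau>"
  using assms(2) wf_prule_lengthD[OF assms(1)]
  by (auto simp: expands_def params_i_def params_ii_def angle_def)

text \<open>Type (ii) is impossible here: its right-hand side has length \<open>h + 1\<close> and
  would require \<open>2 * h + 4\<close> parameters, but there are only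
  \<open>2 * h + 1\<close>.\<close>

lemma expands_complete:
  assumes "wf_prule G r" "expands G r \<tau> q" "2 * length (snd q) + 2 \<le> length \<tau>"
  shows "length (snd q) = length (prhs r)" "length \<tau> = 2 * length (prhs r) + 2"
    and "fst q = Par (plhs r) (\<tau> ! 0) (\<tau> ! (2 * length (prhs r) + 1))"
  using assms wf_prule_lengthD[OF assms(1)]
  by (auto simp: expands_def params_i_def params_ii_def angle_def rule_i_def rule_ii_def)

lemma induced_iff_expands: "q \<in> induced G r \<longleftrightarrow> (\<exists>\<tau>. expands G r \<tau> q)"
  unfolding induced_def expands_def by blast

text \<open>Greedy construction: apply the next function as long as it is defined, and take
  \<open>\<beta>\<close> again for every further subscript. An undefined function closes the rule
  with \<open>Bot\<close> as type (ii); if all symbols are passed, the rule is of type (i).\<close>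

lemma expands_exists:
  assumes "wf_prule G r" "d < length (prhs r)" "\<beta> \<in> params G"
    and "\<rho> \<in> angle G (take (Suc d) (pfuns r))"
  shows "\<exists>\<tau> q. expands G r \<tau> q \<and> take (2 * d + 3) \<tau> = \<rho> @ [\<beta>]"
  using assms(2,4)
proof (induction "length (prhs r) - d" arbitrary: d \<rho> \<beta>' rule: less_induct)
  case less
  note wf = assms(1) and len = wf_prule_lengthD[OF assms(1)]
  have \<rho>: "length \<rho> = 2 * d + 2"
    using less.prems len by (auto simp: angle_def)
  show ?case
  proof (cases "(pfuns r ! Suc d) (\<rho> @ [\<beta>])")
    case None
    \<comment> \<open>The subscript of the left-hand side is arbitrary in type (ii);
      \<open>\<beta>\<close> serves again because it is known to be a parameter.\<close>
    then have "(Suc d, \<rho>, \<beta>, \<beta>) \<in> params_ii G r"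
      using less.prems assms(3) by (simp add: params_ii_def)
    then have "expands G r (\<rho> @ [\<beta>]) (rule_ii r (Suc d) \<rho> \<beta> \<beta>)"
      unfolding expands_def by blast
    then show ?thesis
      using \<rho> by (metis One_nat_def Suc_eq_plus1 add_Suc_right length_append_singleton
          numeral_2_eq_2 numeral_3_eq_3 take_all order_refl)
  next
    case (Some a)
    then have ext: "\<rho> @ [\<beta>] @ [a] \<in> angle G (take (Suc (Suc d)) (pfuns r))"
      using angle_snoc[OF wf _ less.prems(2)] less.prems(1) by simp
    show ?thesis
    proof (cases "Suc d = length (prhs r)")
      case True
      then have "\<rho> @ [\<beta>] @ [a] \<in> params_i G r"
        using ext len by (simp add: params_i_def)
      then have "expands G r (\<rho> @ [\<beta>] @ [a]) (rule_i r (\<rho> @ [\<beta>] @ [a]))"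
        by (simp add: expands_def)
      moreover have "take (2 * d + 3) (\<rho> @ [\<beta>] @ [a]) = \<rho> @ [\<beta>]"
        using \<rho> by simp
      ultimately show ?thesis
        by blast
    next
      case False
      then have "Suc d < length (prhs r)"
        using less.prems(1) by simp
      then obtain \<tau> q where
        "expands G r \<tau> q" "take (2 * Suc d + 3) \<tau> = (\<rho> @ [\<beta>] @ [a]) @ [\<beta>]"
        using less.hyps[of "Suc d", OF _ _ ext] less.prems(1) by fastforce
      moreover have "take (2 * d + 3) \<tau> = take (2 * d + 3) (take (2 * Suc d + 3) \<tau>)"
        by (simp add: min_def)
      moreover have "take (2 * d + 3) ((\<rho> @ [\<beta>] @ [a]) @ [\<beta>]) = \<rho> @ [\<beta>]"
        using \<rho> by simp
      ultimately show ?thesis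
        by metis
    qed
  qed
qed

section \<open>The invariant behind the simulation\<close>

definition wf_items :: "('p, 's, 'c) pgrammar \<Rightarrow> ('p, 's) pitem set \<Rightarrow> bool" where
  "wf_items G I \<longleftrightarrow>
     (\<forall>(r, d, i, j, \<rho>) \<in> I.
        r \<in> prules G \<and> d \<le> length (prhs r) \<and> \<rho> \<in> angle G (take (Suc d) (pfuns r)))"

text \<open>\<open>sim\<close> does not see items with left-hand side \<open>Top\<close>, so what
  they predict is tracked separately. With one symbol on the right, such an item predicts only from
  dot position 0, and \<open>predict' G k\<close> uses only items ending at
  \<open>k\<close>.\<close>

definition top_closed :: "('p, 's, 'c) pgrammar \<Rightarrow> nat \<Rightarrow> ('p, 's) oitem set \<Rightarrow> bool" where
  "top_closed G k I' \<longleftrightarrow>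
     (\<forall>w d i j. ((Top, w), d, i, j) \<in> I' \<longrightarrow> length w = 1 \<and>
        (d = 0 \<longrightarrow> j = k \<longrightarrow> (\<forall>q \<in> irules G. fst q = w ! 0 \<longrightarrow> (q, 0, k, k) \<in> I')))"

text \<open>For \<open>wf_items G I\<close> this is membership in the union of the
  \<open>overline\<close> sets. The bound on \<open>length \<tau>\<close> ensures that
  \<open>take\<close> returns all \<open>2 * d + 2\<close> entries; in type (ii) it amounts to
  \<open>d + 1 \<le> h\<close>.\<close>

definition covered ::
    "('p, 's, 'c) pgrammar \<Rightarrow> ('p, 's) pitem set \<Rightarrow> ('p, 's) oitem \<Rightarrow> bool" where
  "covered G I x \<longleftrightarrow>
     (\<exists>r \<tau> q d i j. x = (q, d, i, j) \<and> expands G r \<tau> q \<and> 2 * d + 2 \<le> length \<tau> \<and>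
        (r, d, i, j, take (2 * d + 2) \<tau>) \<in> I)"

definition sim_inv ::
    "('p, 's, 'c) pgrammar \<Rightarrow> nat \<Rightarrow> ('p, 's) pitem set \<Rightarrow> ('p, 's) oitem set \<Rightarrow> bool" where
  "sim_inv G k I I' \<longleftrightarrow> wf_items G I \<and> top_closed G k I' \<and> sim G I I'"

text \<open>
  Common form of completion and scanning: \<open>P X \<alpha> \<beta> j j'\<close> says that \<open>X\<^sup>\<alpha>\<^sub>\<beta>\<close> is recognized between
  the positions \<open>j\<close> and \<open>j'\<close>.
\<close>

definition advance ::
    "('s \<Rightarrow> 'p \<Rightarrow> 'p \<Rightarrow> nat \<Rightarrow> nat \<Rightarrow> bool) \<Rightarrow> ('p, 's) pitem set \<Rightarrow> ('p, 's) pitem set" where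
  "advance P I = I \<union>
     {(r, Suc d, i, j', \<rho> @ [\<beta>] @ [a]) | r d i j j' \<rho> \<beta> a.
        (r, d, i, j, \<rho>) \<in> I \<and> d < length (prhs r) \<and> P (prhs r ! d) (\<rho> ! (2 * d + 1)) \<beta> j j' \<and>
        (pfuns r ! Suc d) (\<rho> @ [\<beta>]) = Some a}"

definition advance' ::
    "(('p, 's) isym \<Rightarrow> nat \<Rightarrow> nat \<Rightarrow> bool) \<Rightarrow> ('p, 's) oitem set \<Rightarrow> ('p, 's) oitem set" where
  "advance' P' I' = I' \<union>
     {(q, Suc d, i, j') | q d i j j'.
        (q, d, i, j) \<in> I' \<and> d < length (snd q) \<and> P' (snd q ! d) j j'}"

section \<open>Ordinary items and steps with the dot given by an index\<close>

lemma in_norm_items_iff: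
  "(q, d, i, j) \<in> norm_items I' \<longleftrightarrow>
     (q, d, i, j) \<in> I' \<and> fst q \<noteq> Top \<and> drop d (snd q) \<noteq> [Bot]"
  by (cases q) (auto simp: norm_items_def)

lemma split_at_dot:
  "(\<exists>a b. w = a @ X # b \<and> d = length a) \<longleftrightarrow> d < length w \<and> w ! d = X"
  by (auto simp: nth_append) (metis id_take_nth_drop length_take min.absorb4)

lemma in_predict'_iff:
  "x \<in> predict' G k I' \<longleftrightarrow> x \<in> I' \<or>
     (\<exists>q d i q'. x = (q', 0, k, k) \<and> (q, d, i, k) \<in> I' \<and> d < length (snd q) \<and>
        snd q ! d = fst q' \<and> q' \<in> irules G)" (is "_ \<longleftrightarrow> _ \<or> ?R")
proof -
  have "?R \<longleftrightarrow> (\<exists>L v d i M w. x = ((M, w), 0, k, k) \<and> ((L, v), d, i, k) \<in> I' \<and>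
      (\<exists>a b. v = a @ M # b \<and> d = length a) \<and> (M, w) \<in> irules G)"
    unfolding split_at_dot by auto
  then show ?thesis
    unfolding predict'_def by blast
qed

lemma in_complete'_iff:
  "x \<in> complete' k I' \<longleftrightarrow> x \<in> I' \<or>
     (\<exists>q d i j q'. x = (q, Suc d, i, k) \<and> (q, d, i, j) \<in> I' \<and> d < length (snd q) \<and>
        snd q ! d = fst q' \<and> (q', length (snd q'), j, k) \<in> I')" (is "_ \<longleftrightarrow> _ \<or> ?R")
proof -
  have "?R \<longleftrightarrow> (\<exists>L v d i j M w. x = ((L, v), d + 1, i, k) \<and> ((L, v), d, i, j) \<in> I' \<and>
      (\<exists>a b. v = a @ M # b \<and> d = length a) \<and> ((M, w), length w, j, k) \<in> I')"
    unfolding split_at_dot by auto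
  then show ?thesis
    unfolding complete'_def by blast
qed

lemma in_scan'_iff:
  "x \<in> scan' T' k I' \<longleftrightarrow> x \<in> I' \<or>
     (\<exists>q d i c. x = (q, Suc d, i, k + length c) \<and> (q, d, i, k) \<in> I' \<and> d < length (snd q) \<and>
        (snd q ! d, c) \<in> T')" (is "_ \<longleftrightarrow> _ \<or> ?R")
proof -
  have "?R \<longleftrightarrow> (\<exists>L v d i t c. x = ((L, v), d + 1, i, k + length c) \<and> ((L, v), d, i, k) \<in> I' \<and>
      (\<exists>a b. v = a @ t # b \<and> d = length a) \<and> (t, c) \<in> T')"
    unfolding split_at_dot by auto
  then show ?thesis
    unfolding scan'_def by blast
qed

section \<open>Coverage of ordinary items and consequences of the invariant\<close>

context
  fixes G :: "('p, 's, 'c) pgrammar"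
  assumes G: "parameterized_local_lexing G"
begin

lemma wf_rule: "r \<in> prules G \<Longrightarrow> wf_prule G r"
  using G by (simp add: parameterized_local_lexing_def)

lemma wf_itemsD:
  assumes "wf_items G I" "(r, d, i, j, \<rho>) \<in> I"
  shows "r \<in> prules G" "wf_prule G r" "d \<le> length (prhs r)"
    "\<rho> \<in> angle G (take (Suc d) (pfuns r))" "length \<rho> = 2 * d + 2"
proof -
  show *: "r \<in> prules G" "d \<le> length (prhs r)" "\<rho> \<in> angle G (take (Suc d) (pfuns r))"
    using assms by (auto simp: wf_items_def)
  show wf: "wf_prule G r"
    by (rule wf_rule) fact
  show "length \<rho> = 2 * d + 2"
    using * wf_prule_lengthD[OF wf] by (auto simp: angle_def)
qed

text \<open>In type (ii) \<open>\<sigma> @ [b]\<close> has odd length \<open>2 * h + 1\<close>, so a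
  prefix of length \<open>2 * d + 2\<close> exists only for \<open>d + 1 \<le> h\<close> and then
  never reaches \<open>b\<close>.\<close>

lemma overline_eq:
  assumes "wf_items G I" "(r, d, i, j, \<rho>) \<in> I"
  shows "overline G (r, d, i, j, \<rho>) =
    {(q, d, i, j) | q \<tau>. expands G r \<tau> q \<and> 2 * d + 2 \<le> length \<tau> \<and> take (2 * d + 2) \<tau> = \<rho>}"
    (is "_ = ?R")
proof -
  note D = wf_itemsD[OF assms]
  note len = wf_prule_lengthD[OF D(2)]
  have i: "length \<sigma> = 2 * length (prhs r) + 2" if "\<sigma> \<in> params_i G r" for \<sigma>
    using that len by (simp add: params_i_def angle_def)
  have ii: "length \<sigma> = 2 * h" if "(h, \<sigma>, b, \<beta>) \<in> params_ii G r" for h \<sigma> b \<beta>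
    using that len by (simp add: params_ii_def angle_def)
  have "?R = {(q, d, i, j) | q \<tau>. expands G r \<tau> q \<and> take (2 * d + 2) \<tau> = \<rho>}"
  proof -
    have "2 * d + 2 \<le> length \<tau>" if "take (2 * d + 2) \<tau> = \<rho>" for \<tau>
      using D(5) unfolding that[symmetric] by simp
    then show ?thesis
      by blast
  qed
  also have "\<dots> = {(rule_i r \<sigma>, d, i, j) | \<sigma>. \<sigma> \<in> params_i G r \<and> take (2 * d + 2) \<sigma> = \<rho>} \<union>
     {(rule_ii r h \<sigma> b \<beta>, d, i, j) | h \<sigma> b \<beta>.
        (h, \<sigma>, b, \<beta>) \<in> params_ii G r \<and> take (2 * d + 2) (\<sigma> @ [b]) = \<rho>}"
    unfolding expands_def by blast
  also have "\<dots> = overline G (r, d, i, j, \<rho>)"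
  proof -
    have "take (2 * d + 2) (\<sigma> @ [b]) = \<rho> \<longleftrightarrow> d + 1 \<le> h \<and> take (2 * d + 2) \<sigma> = \<rho>"
      if "(h, \<sigma>, b, \<beta>) \<in> params_ii G r" for h \<sigma> b \<beta>
    proof
      assume *: "take (2 * d + 2) (\<sigma> @ [b]) = \<rho>"
      then have "length (take (2 * d + 2) (\<sigma> @ [b])) = 2 * d + 2"
        using D(5) by simp
      then have "d + 1 \<le> h"
        using ii[OF that] by simp
      then show "d + 1 \<le> h \<and> take (2 * d + 2) \<sigma> = \<rho>"
        using * ii[OF that] by simp
    qed (use ii[OF that] in auto)
    then show ?thesis
      by (simp del: take_append cong: conj_cong)
  qed
  finally show ?thesis ..
qed

lemma in_overlines_iff:
  assumes "wf_items G I"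
  shows "x \<in> (\<Union>y \<in> I. overline G y) \<longleftrightarrow> covered G I x"
proof -
  have "x \<in> (\<Union>y \<in> I. overline G y) \<longleftrightarrow>
      (\<exists>r d i j \<rho>. (r, d, i, j, \<rho>) \<in> I \<and> x \<in> overline G (r, d, i, j, \<rho>))"
    by (simp del: overline.simps add: Bex_def split_paired_Ex)
  also have "\<dots> \<longleftrightarrow> (\<exists>r d i j \<rho>. (r, d, i, j, \<rho>) \<in> I \<and>
      x \<in> {(q, d, i, j) | q \<tau>. expands G r \<tau> q \<and> 2 * d + 2 \<le> length \<tau> \<and> take (2 * d + 2) \<tau> = \<rho>})"
    using overline_eq[OF assms] by (intro ex_cong1 conj_cong refl) blast
  also have "\<dots> \<longleftrightarrow> covered G I x"
    unfolding covered_def by blast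
  finally show ?thesis .
qed

lemma sim_iff_covered:
  assumes "wf_items G I"
  shows "sim G I I' \<longleftrightarrow> (\<forall>x. covered G I x \<longleftrightarrow> x \<in> norm_items I')"
  using in_overlines_iff[OF assms] by (auto simp: sim_def set_eq_iff)

text \<open>Rules given by \<open>expands\<close> have a \<open>Par\<close> on the left, and a
  parameter list long enough for the dot excludes a remaining \<open>[Bot]\<close>. So for covered
  items membership in \<open>I'\<close> is the only thing to check.\<close>

lemma covered_in_norm:
  assumes "wf_items G I" "covered G I (q, d, i, j)" "(q, d, i, j) \<in> I'"
  shows "(q, d, i, j) \<in> norm_items I'"
proof -
  obtain r \<tau> where *: "expands G r \<tau> q" "2 * d + 2 \<le> length \<tau>"
    "(r, d, i, j, take (2 * d + 2) \<tau>) \<in> I"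
    using assms(2) by (auto simp: covered_def)
  note wf = wf_itemsD(2)[OF assms(1) *(3)]
  show ?thesis
    using expands_length(3)[OF wf *(1,2)] expands_fst[OF wf *(1)] assms(3)
    by (metis in_norm_items_iff isym.distinct(1))
qed

lemma irules_cases:
  assumes "q \<in> irules G" "fst q \<noteq> Top"
  obtains r \<tau> where "r \<in> prules G" "expands G r \<tau> q"
  using assms by (auto simp: irules_def induced_iff_expands)

lemma expands_in_irules: "r \<in> prules G \<Longrightarrow> expands G r \<tau> q \<Longrightarrow> q \<in> irules G"
  unfolding irules_def using induced_iff_expands by blast

text \<open>This makes \<open>Bot\<close> a dead end: nothing is predicted from an item with
  \<open>Bot\<close> behind the dot.\<close>

lemma Bot_notin_irules: "q \<in> irules G \<Longrightarrow> fst q \<noteq> Bot"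
  by (metis expands_fst irules_cases isym.distinct(3,5) wf_rule)

lemma sim_invD:
  assumes "sim_inv G k I I'"
  shows "wf_items G I" "top_closed G k I'"
    and "covered G I (q, d, i, j) \<longleftrightarrow> (q, d, i, j) \<in> I' \<and> fst q \<noteq> Top \<and> drop d (snd q) \<noteq> [Bot]"
proof -
  show *: "wf_items G I" "top_closed G k I'"
    using assms by (auto simp: sim_inv_def)
  show "covered G I (q, d, i, j) \<longleftrightarrow> (q, d, i, j) \<in> I' \<and> fst q \<noteq> Top \<and> drop d (snd q) \<noteq> [Bot]"
    using assms sim_iff_covered[OF *(1), of I'] unfolding sim_inv_def in_norm_items_iff[symmetric]
    by blast
qed

text \<open>A symbol other than \<open>Bot\<close> behind the dot keeps the item in
  \<open>norm_items\<close>, hence covered, and forces \<open>\<tau>\<close> to contain the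
  subscript of that symbol at index \<open>2 * d + 2\<close>.\<close>

lemma sim_inv_item:
  assumes "sim_inv G k I I'" "(q, d, i, j) \<in> I'" "fst q \<noteq> Top"
    and "d < length (snd q)" "snd q ! d \<noteq> Bot"
  obtains r \<tau> where "r \<in> prules G" "wf_prule G r" "expands G r \<tau> q" "2 * d + 2 < length \<tau>"
    "(r, d, i, j, take (2 * d + 2) \<tau>) \<in> I" "d < length (prhs r)"
    "snd q ! d = Par (prhs r ! d) (\<tau> ! (2 * d + 1)) (\<tau> ! (2 * d + 2))"
proof -
  have "drop d (snd q) \<noteq> [Bot]"
    using assms(4,5) by (metis Cons_nth_drop_Suc list.inject)
  then have "covered G I (q, d, i, j)"
    using assms sim_invD(3)[OF assms(1)] by blast
  then obtain r \<tau> where *: "expands G r \<tau> q" "(r, d, i, j, take (2 * d + 2) \<tau>) \<in> I"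
    by (auto simp: covered_def)
  note wf = wf_itemsD(1,2)[OF sim_invD(1)[OF assms(1)] *(2)]
  have "2 * d + 2 < length \<tau>"
    using expands_length(1)[OF wf(2) *(1)] assms(4,5) by blast
  then show thesis
    using that[OF wf *(1) _ *(2)] expands_nth[OF wf(2) *(1)] by blast
qed

text \<open>As both sides only grow, the equivalence has to be checked for new items only; old ones
  are settled by the invariant.\<close>

lemma sim_inv_unionI:
  assumes "sim_inv G k I I'" "wf_items G J" "top_closed G k J'" "I \<subseteq> J" "I' \<subseteq> J'"
    and "\<And>x. covered G J x \<Longrightarrow> \<not> covered G I x \<Longrightarrow> x \<in> J'"
    and "\<And>q d i j. (q, d, i, j) \<in> J' \<Longrightarrow> (q, d, i, j) \<notin> I' \<Longrightarrow> fst q \<noteq> Top \<Longrightarrow>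
      drop d (snd q) \<noteq> [Bot] \<Longrightarrow> covered G J (q, d, i, j)"
  shows "sim_inv G k J J'"
proof -
  have mono: "covered G J x" if "covered G I x" for x
    using that assms(4) unfolding covered_def by blast
  have "covered G J (q, d, i, j) \<longleftrightarrow> (q, d, i, j) \<in> norm_items J'" for q d i j
  proof
    assume *: "covered G J (q, d, i, j)"
    then have "(q, d, i, j) \<in> J'"
      using sim_invD(3)[OF assms(1)] assms(5,6) by blast
    then show "(q, d, i, j) \<in> norm_items J'"
      using covered_in_norm[OF assms(2) *] by blast
  next
    assume *: "(q, d, i, j) \<in> norm_items J'"
    show "covered G J (q, d, i, j)"
    proof (cases "(q, d, i, j) \<in> I'")
      case True
      then have "covered G I (q, d, i, j)"
        using sim_invD(3)[OF assms(1)] * by (auto simp: in_norm_items_iff)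
      then show ?thesis
        by (rule mono)
    next
      case False
      then show ?thesis
        using * assms(7) by (auto simp: in_norm_items_iff)
    qed
  qed
  then show ?thesis
    using assms(2,3) by (auto simp: sim_inv_def sim_iff_covered)
qed

section \<open>Prediction\<close>

lemma in_irules_expands:
  assumes "q \<in> irules G" "fst q \<noteq> Top"
  obtains r \<tau> \<beta> where "r \<in> prules G" "wf_prule G r" "expands G r \<tau> q"
    "fst q = Par (plhs r) (\<tau> ! 0) \<beta>"
  by (metis assms expands_fst irules_cases wf_rule)

text \<open>What \<open>Top\<close> items predict is already in \<open>I'\<close> by
  \<open>top_closed\<close>, so every new item stems from an item that \<open>sim\<close> can
  see.\<close>

lemma predict'_newE:
  assumes "top_closed G k I'" "(q, d, i, j) \<in> predict' G k I'" "(q, d, i, j) \<notin> I'"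
  obtains p e l where "(p, e, l, k) \<in> I'" "e < length (snd p)" "snd p ! e = fst q"
    "fst p \<noteq> Top" "q \<in> irules G" "d = 0" "i = k" "j = k"
proof -
  obtain p e l where p: "(p, e, l, k) \<in> I'" "e < length (snd p)"
    "snd p ! e = fst q" "q \<in> irules G" and x: "d = 0" "i = k" "j = k"
    using assms(2,3) unfolding in_predict'_iff by blast
  moreover have "fst p \<noteq> Top"
  proof
    assume Top: "fst p = Top"
    then have "length (snd p) = 1" "e = 0"
      using assms(1) p(1,2) by (cases p; force simp: top_closed_def)+
    then have "(q, 0, k, k) \<in> I'"
      using assms(1) p Top by (cases p) (force simp: top_closed_def)
    then show False
      using x assms(3) by simp
  qed
  ultimately show thesis
    using that by blast
qed

text \<open>A predicting parameterized item fixes only the superscript of the predicted symbol; for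
  each subscript, a covered ordinary item carrying it behind the dot has to be found.\<close>

lemma sim_inv_predict:
  assumes inv: "sim_inv G k I I'"
  shows "sim_inv G k (predict G k I) (predict' G k I')"
proof (rule sim_inv_unionI[OF inv])
  note wf = sim_invD(1)[OF inv] and top = sim_invD(2)[OF inv]
  show "I \<subseteq> predict G k I" "I' \<subseteq> predict' G k I'"
    by (auto simp: predict_def predict'_def)
  show "wf_items G (predict G k I)"
    unfolding wf_items_def
  proof safe
    fix r d i j \<rho> assume *: "(r, d, i, j, \<rho>) \<in> predict G k I"
    have "r \<in> prules G \<and> d \<le> length (prhs r) \<and> \<rho> \<in> angle G (take (Suc d) (pfuns r))"
    proof (cases "(r, d, i, j, \<rho>) \<in> I")
      case True
      then show ?thesis
        using wf_itemsD[OF wf] by blast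
    next
      case False
      then obtain \<alpha> a where new: "d = 0" "\<rho> = [\<alpha>, a]" "r \<in> prules G"
        "(pfuns r ! 0) [\<alpha>] = Some a"
        using * by (auto simp: predict_def)
      \<comment> \<open>The predicted pair arises from the empty tuple by one application of
        \<open>angle_snoc\<close>.\<close>
      have "[] \<in> angle G (take 0 (pfuns r))"
        by (simp add: angle_def)
      then have "[] @ [\<alpha>] @ [a] \<in> angle G (take (Suc 0) (pfuns r))"
        using angle_snoc[OF wf_rule[OF new(3)]] new(4) by fastforce
      then show ?thesis
        using new by simp
    qed
    then show "r \<in> prules G" "d \<le> length (prhs r)" "\<rho> \<in> angle G (take (Suc d) (pfuns r))"
      by auto
  qed
  show "top_closed G k (predict' G k I')"
  proof -
    \<comment> \<open>No \<open>Top\<close> item is new: \<open>Top\<close> would have to stand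
      behind the dot of a covered item, where only \<open>Par\<close> symbols occur.\<close>
    have "(q, d, i, j) \<in> I'" if new: "(q, d, i, j) \<in> predict' G k I'" "fst q = Top" for q d i j
    proof (rule ccontr)
      assume "(q, d, i, j) \<notin> I'"
      then obtain p e l where p: "(p, e, l, k) \<in> I'" "e < length (snd p)"
        "snd p ! e = fst q" "fst p \<noteq> Top"
        using predict'_newE[OF top new(1) \<open>(q, d, i, j) \<notin> I'\<close>] by metis
      then show False
        using sim_inv_item[OF inv p(1,4,2)] p(3) new(2) by (metis isym.distinct(1,5))
    qed
    then show ?thesis
      using top unfolding top_closed_def by (fastforce simp: in_predict'_iff)
  qed
  show "x \<in> predict' G k I'" if cov: "covered G (predict G k I) x" "\<not> covered G I x" for x
  proof -
    obtain r \<tau> q d i j where x: "x = (q, d, i, j)" "expands G r \<tau> q" "2 * d + 2 \<le> length \<tau>"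
      "(r, d, i, j, take (2 * d + 2) \<tau>) \<in> predict G k I"
      using cov(1) unfolding covered_def by blast
    have "(r, d, i, j, take (2 * d + 2) \<tau>) \<notin> I"
      using x cov(2) unfolding covered_def by blast
    then obtain r0 e l \<rho> a where new: "(r0, e, l, k, \<rho>) \<in> I" "e < length (prhs r0)"
      "r \<in> prules G" "prhs r0 ! e = plhs r" "d = 0" "i = k" "j = k"
      "take (2 * d + 2) \<tau> = [\<rho> ! (2 * e + 1), a]"
      using x(4) by (auto simp: predict_def)
    have \<tau>0: "\<tau> ! 0 = \<rho> ! (2 * e + 1)"
      using arg_cong[OF new(8), of "\<lambda>xs. xs ! 0"] by simp
    obtain \<beta> where \<beta>: "fst q = Par (plhs r) (\<tau> ! 0) \<beta>" "\<beta> \<in> params G"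
      using expands_fst[OF wf_rule[OF new(3)] x(2)] .
    note D = wf_itemsD[OF wf new(1)]
    \<comment> \<open>The subscript of \<open>fst q\<close> is passed as the next parameter, so that
      the symbol of \<open>p\<close> behind the dot becomes exactly \<open>fst q\<close>.\<close>
    obtain \<tau>' p where p: "expands G r0 \<tau>' p" "take (2 * e + 3) \<tau>' = \<rho> @ [\<beta>]"
      using expands_exists[OF D(2) new(2) \<beta>(2) D(4)] by blast
    have "length (take (2 * e + 3) \<tau>') = 2 * e + 3"
      unfolding p(2) using D(5) by simp
    then have len: "2 * e + 2 < length \<tau>'"
      by simp
    have "take (2 * e + 2) (take (2 * e + 3) \<tau>') = \<rho>"
      unfolding p(2) using D(5) by simp
    then have take: "take (2 * e + 2) \<tau>' = \<rho>"
      by (simp add: min_def)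
    have "take (2 * e + 3) \<tau>' ! (2 * e + 2) = \<beta>"
      unfolding p(2) using D(5) by (simp add: nth_append)
    then have "\<tau>' ! (2 * e + 2) = \<beta>"
      by simp
    moreover have "\<tau>' ! (2 * e + 1) = \<rho> ! (2 * e + 1)"
      using take by (metis nth_take add_less_cancel_left one_less_numeral_iff semiring_norm(76))
    ultimately have "snd p ! e = fst q"
      using expands_nth(2)[OF D(2) p(1) len] new(4) \<beta>(1) \<tau>0 by simp
    moreover have "e < length (snd p)"
      using expands_length(1)[OF D(2) p(1)] len by blast
    moreover have "covered G I (p, e, l, k)"
      unfolding covered_def using p(1) len take new(1) by fastforce
    then have "(p, e, l, k) \<in> I'"
      using sim_invD(3)[OF inv] by blast
    ultimately show ?thesis
      unfolding x(1) new(5-7) in_predict'_iff using expands_in_irules[OF new(3) x(2)] by blast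
  qed
  show "covered G (predict G k I) (q, d, i, j)"
    if new: "(q, d, i, j) \<in> predict' G k I'" "(q, d, i, j) \<notin> I'" "fst q \<noteq> Top" for q d i j
  proof -
    obtain p e l where p: "(p, e, l, k) \<in> I'" "e < length (snd p)"
      "snd p ! e = fst q" "q \<in> irules G" "fst p \<noteq> Top" and x: "d = 0" "i = k" "j = k"
      using predict'_newE[OF top new(1,2)] by metis
    obtain r0 \<tau>0 where r0: "expands G r0 \<tau>0 p" "2 * e + 2 < length \<tau>0"
      "(r0, e, l, k, take (2 * e + 2) \<tau>0) \<in> I" "e < length (prhs r0)"
      "snd p ! e = Par (prhs r0 ! e) (\<tau>0 ! (2 * e + 1)) (\<tau>0 ! (2 * e + 2))"
      using sim_inv_item[OF inv p(1,5,2)] Bot_notin_irules[OF p(4)] p(3) by metis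
    obtain r \<tau> \<beta> where r: "r \<in> prules G" "wf_prule G r" "expands G r \<tau> q"
      "fst q = Par (plhs r) (\<tau> ! 0) \<beta>"
      using in_irules_expands[OF p(4) new(3)] .
    have len: "2 \<le> length \<tau>"
      using expands_length_ge[OF r(2,3)] .
    then have take: "take 1 \<tau> = [\<tau> ! 0]" "take 2 \<tau> = [\<tau> ! 0, \<tau> ! 1]"
      by (cases \<tau>; cases "tl \<tau>"; auto)+
    \<comment> \<open>The value computed by the parameterized prediction is the second entry of
      \<open>\<tau>\<close>, so the predicted item carries a prefix of \<open>\<tau>\<close> and
      covers \<open>q\<close>.\<close>
    have "(pfuns r ! 0) [\<tau> ! 0] = Some (\<tau> ! 1)"
      using expands_fun[OF r(2,3), of 0] len take by simp
    moreover have \<tau>0: "take (2 * e + 2) \<tau>0 ! (2 * e + 1) = \<tau> ! 0" and "prhs r0 ! e = plhs r"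
      using r0(5) r(4) p(3) by auto
    ultimately have "(r, 0, k, k, [take (2 * e + 2) \<tau>0 ! (2 * e + 1), \<tau> ! 1]) \<in> predict G k I"
      unfolding predict_def using r0(3,4) r(1) by (subst (asm) \<tau>0[symmetric]) blast
    then have "(r, 0, k, k, [\<tau> ! 0, \<tau> ! 1]) \<in> predict G k I"
      unfolding \<tau>0 .
    then show ?thesis
      unfolding take(2)[symmetric] covered_def x using r(3) len
      by (intro exI[of _ r] exI[of _ \<tau>]) (simp add: numeral_2_eq_2)
  qed
qed

section \<open>Scanning and completion\<close>

text \<open>Moving the dot keeps \<open>q\<close> and exposes two more entries of the same
  \<open>\<tau>\<close>: the recognized subscript and the next function value. That value is present
  exactly when the new remaining string is not \<open>[Bot]\<close>, the case kept by
  \<open>norm_items\<close>.\<close>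

lemma sim_inv_advance:
  assumes inv: "sim_inv G k I I'"
    and P: "\<And>X \<alpha> \<beta> j j'. P' (Par X \<alpha> \<beta>) j j' \<longleftrightarrow> P X \<alpha> \<beta> j j'" "\<And>j j'. \<not> P' Bot j j'"
  shows "sim_inv G k (advance P I) (advance' P' I')"
proof (rule sim_inv_unionI[OF inv])
  note wf = sim_invD(1)[OF inv] and top = sim_invD(2)[OF inv]
  show "I \<subseteq> advance P I" "I' \<subseteq> advance' P' I'"
    by (auto simp: advance_def advance'_def)
  show "wf_items G (advance P I)"
    unfolding wf_items_def
  proof safe
    fix r d i j \<rho> assume *: "(r, d, i, j, \<rho>) \<in> advance P I"
    have "r \<in> prules G \<and> d \<le> length (prhs r) \<and> \<rho> \<in> angle G (take (Suc d) (pfuns r))"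
    proof (cases "(r, d, i, j, \<rho>) \<in> I")
      case True
      then show ?thesis
        using wf_itemsD[OF wf] by blast
    next
      case False
      then obtain e l \<rho>0 \<beta> a where new: "(r, e, i, l, \<rho>0) \<in> I" "e < length (prhs r)"
        "d = Suc e" "\<rho> = \<rho>0 @ [\<beta>] @ [a]" "(pfuns r ! Suc e) (\<rho>0 @ [\<beta>]) = Some a"
        using * unfolding advance_def by blast
      note D = wf_itemsD[OF wf new(1)]
      show ?thesis
        using angle_snoc[OF D(2) _ D(4) new(5)] new D(1) by simp
    qed
    then show "r \<in> prules G" "d \<le> length (prhs r)" "\<rho> \<in> angle G (take (Suc d) (pfuns r))"
      by auto
  qed
  show "top_closed G k (advance' P' I')"
    \<comment> \<open>New items have a positive dot position, so the closure clause concerns old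
      items only.\<close>
    using top unfolding top_closed_def advance'_def by fastforce
  show "x \<in> advance' P' I'" if cov: "covered G (advance P I) x" "\<not> covered G I x" for x
  proof -
    obtain r \<tau> q d i j where x: "x = (q, d, i, j)" "expands G r \<tau> q" "2 * d + 2 \<le> length \<tau>"
      "(r, d, i, j, take (2 * d + 2) \<tau>) \<in> advance P I"
      using cov(1) unfolding covered_def by blast
    have "(r, d, i, j, take (2 * d + 2) \<tau>) \<notin> I"
      using x cov(2) unfolding covered_def by blast
    then obtain e l \<rho> \<beta> a where new: "(r, e, i, l, \<rho>) \<in> I" "e < length (prhs r)"
      "P (prhs r ! e) (\<rho> ! (2 * e + 1)) \<beta> l j"
      "d = Suc e" "take (2 * d + 2) \<tau> = \<rho> @ [\<beta>] @ [a]"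
      using x(4) unfolding advance_def by blast
    note D = wf_itemsD[OF wf new(1)]
    \<comment> \<open>The same \<open>\<tau>\<close> and \<open>q\<close>, cut at the shorter
      prefix, witness that the item before the advance was covered.\<close>
    have "take (2 * e + 2) (take (2 * d + 2) \<tau>) = \<rho>"
      unfolding new(5) using D(5) by simp
    then have take: "take (2 * e + 2) \<tau> = \<rho>"
      using new(4) by (simp add: min_def)
    have len: "2 * e + 2 < length \<tau>"
      using x(3) new(4) by simp
    have "take (2 * d + 2) \<tau> ! (2 * e + 2) = \<beta>"
      unfolding new(5) using D(5) by (simp add: nth_append)
    then have "\<tau> ! (2 * e + 2) = \<beta>"
      using new(4) by simp
    moreover have "\<tau> ! (2 * e + 1) = \<rho> ! (2 * e + 1)"
      using take by (metis nth_take add_less_cancel_left one_less_numeral_iff semiring_norm(76))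
    ultimately have "P' (snd q ! e) l j"
      using expands_nth(2)[OF D(2) x(2) len] new(3) P(1) by simp
    moreover have "e < length (snd q)"
      using expands_length(1)[OF D(2) x(2)] len by blast
    moreover have "covered G I (q, e, i, l)"
      unfolding covered_def using x(2) len take new(1) by fastforce
    then have "(q, e, i, l) \<in> I'"
      using sim_invD(3)[OF inv] by blast
    ultimately show ?thesis
      unfolding x(1) new(4) advance'_def by blast
  qed
  show "covered G (advance P I) (q, d, i, j)"
    if x: "(q, d, i, j) \<in> advance' P' I'" "(q, d, i, j) \<notin> I'" "fst q \<noteq> Top" "drop d (snd q) \<noteq> [Bot]"
    for q d i j
  proof -
    obtain e l where new: "(q, e, i, l) \<in> I'" "e < length (snd q)" "P' (snd q ! e) l j" "d = Suc e"
      using x(1,2) unfolding advance'_def by blast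
    obtain r \<tau> where r: "wf_prule G r" "expands G r \<tau> q" "2 * e + 2 < length \<tau>"
      "(r, e, i, l, take (2 * e + 2) \<tau>) \<in> I" "e < length (prhs r)"
      "snd q ! e = Par (prhs r ! e) (\<tau> ! (2 * e + 1)) (\<tau> ! (2 * e + 2))"
      using sim_inv_item[OF inv new(1) x(3) new(2)] new(3) P(2) by metis
    \<comment> \<open>This is where \<open>drop d (snd q) \<noteq> [Bot]\<close> enters: it
      guarantees that the function value after the recognized subscript is part of
      \<open>\<tau>\<close>.\<close>
    have len: "2 * d + 2 \<le> length \<tau>"
      using expands_length(2)[OF r(1-3)] x(4) new(4) by blast
    have take: "take (2 * e + 2) \<tau> @ [\<tau> ! (2 * e + 2)] = take (2 * e + 3) \<tau>"
      using take_Suc_conv_app_nth[OF r(3)] by (simp add: numeral_3_eq_3)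
    then have take': "take (2 * e + 2) \<tau> @ [\<tau> ! (2 * e + 2)] @ [\<tau> ! (2 * e + 3)] = take (2 * d + 2) \<tau>"
      using take_Suc_conv_app_nth[of "2 * e + 3" \<tau>] len new(4) by (simp add: numeral_3_eq_3)
    have "(pfuns r ! Suc e) (take (2 * e + 2) \<tau> @ [\<tau> ! (2 * e + 2)]) = Some (\<tau> ! (2 * e + 3))"
      using expands_fun[OF r(1,2), of "Suc e"] len new(4) unfolding take
      by (simp add: numeral_3_eq_3)
    moreover have "P (prhs r ! e) (take (2 * e + 2) \<tau> ! (2 * e + 1)) (\<tau> ! (2 * e + 2)) l j"
      using new(3) r(6) P(1) by simp
    ultimately have "(r, Suc e, i, j,
        take (2 * e + 2) \<tau> @ [\<tau> ! (2 * e + 2)] @ [\<tau> ! (2 * e + 3)]) \<in> advance P I"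
      unfolding advance_def using r(4,5) by blast
    then show ?thesis
      unfolding take' using r(2) len new(4) unfolding covered_def by blast
  qed
qed

lemma sim_inv_scan:
  assumes "sim_inv G k I I'"
  shows "sim_inv G k (scan T k I) (scan' (unparam T) k I')"
proof -
  let ?P = "\<lambda>X \<alpha> \<beta> j j'. j = k \<and> (\<exists>c. (X, \<alpha>, \<beta>, c) \<in> T \<and> j' = k + length c)"
  let ?P' = "\<lambda>t j j'. j = k \<and> (\<exists>c. (t, c) \<in> unparam T \<and> j' = k + length c)"
  have "scan T k I = advance ?P I"
    unfolding scan_def advance_def by auto
  moreover have "scan' (unparam T) k I' = advance' ?P' I'"
    by (rule set_eqI) (unfold in_scan'_iff advance'_def, blast)
  moreover have "sim_inv G k (advance ?P I) (advance' ?P' I')"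
    \<comment> \<open>\<open>unparam\<close> sends tokens injectively to \<open>Par\<close> symbols,
      which gives both assumptions on \<open>P'\<close>.\<close>
    by (rule sim_inv_advance[OF assms]) (force simp: unparam_def)+
  ultimately show ?thesis
    by simp
qed

lemma sim_inv_complete:
  assumes inv: "sim_inv G k I I'"
  shows "sim_inv G k (complete k I) (complete' k I')"
proof -
  let ?P = "\<lambda>X \<alpha> \<beta> j j'. j' = k \<and> (\<exists>r \<xi>. (r, length (prhs r), j, k, \<xi>) \<in> I \<and> X = plhs r \<and>
    \<alpha> = \<xi> ! 0 \<and> \<beta> = \<xi> ! (2 * length (prhs r) + 1))"
  let ?P' = "\<lambda>t j j'. j' = k \<and> (\<exists>q. (q, length (snd q), j, k) \<in> I' \<and> t = fst q)"
  note wf = sim_invD(1)[OF inv]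
  \<comment> \<open>Finished items must be recognized alike on both sides. \<open>Top\<close> is
    excluded because \<open>sim\<close> does not see finished \<open>Top\<close> items; for
    \<open>t = Bot\<close> the right side is false, so the equivalence also rules out completion
    over \<open>Bot\<close>.\<close>
  have iff: "?P' t j j' \<longleftrightarrow> (\<exists>X \<alpha> \<beta>. t = Par X \<alpha> \<beta> \<and> ?P X \<alpha> \<beta> j j')" if "t \<noteq> Top" for t j j'
  proof safe
    fix q assume q: "(q, length (snd q), j, k) \<in> I'" "t = fst q"
    then have "covered G I (q, length (snd q), j, k)"
      using sim_invD(3)[OF inv] that by simp
    then obtain r \<tau> where r: "expands G r \<tau> q" "2 * length (snd q) + 2 \<le> length \<tau>"
      "(r, length (snd q), j, k, take (2 * length (snd q) + 2) \<tau>) \<in> I"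
      unfolding covered_def by blast
    note e = expands_complete[OF wf_itemsD(2)[OF wf r(3)] r(1,2)]
    show "\<exists>X \<alpha> \<beta>. fst q = Par X \<alpha> \<beta> \<and> ?P X \<alpha> \<beta> j k"
      using r(3) e by auto
  next
    fix r \<xi> assume r: "(r, length (prhs r), j, k, \<xi>) \<in> I"
    note D = wf_itemsD[OF wf r]
    \<comment> \<open>With the dot at the end, the functions taken are all of
      \<open>pfuns r\<close>, so \<open>\<xi>\<close> is itself the parameter list of a type (i)
      rule.\<close>
    have "expands G r \<xi> (rule_i r \<xi>)"
      using D(4) wf_prule_lengthD[OF D(2)] by (simp add: expands_def params_i_def)
    then have "covered G I (rule_i r \<xi>, length (prhs r), j, k)"
      unfolding covered_def using r D(5) by fastforce
    then have "(rule_i r \<xi>, length (prhs r), j, k) \<in> I'"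
      using sim_invD(3)[OF inv] by blast
    then show "\<exists>q. (q, length (snd q), j, k) \<in> I' \<and>
        Par (plhs r) (\<xi> ! 0) (\<xi> ! (2 * length (prhs r) + 1)) = fst q"
      by (intro exI[of _ "rule_i r \<xi>"]) (simp add: rule_i_def)
  qed
  have "complete k I = advance ?P I"
    unfolding complete_def advance_def
    by (intro arg_cong2[where f = "(\<union>)"] refl Collect_cong) (auto; metis)
  moreover have "complete' k I' = advance' ?P' I'"
    by (rule set_eqI) (unfold in_complete'_iff advance'_def, blast)
  moreover have "sim_inv G k (advance ?P I) (advance' ?P' I')"
    by (rule sim_inv_advance[OF inv]) (subst iff; blast)+
  ultimately show ?thesis
    by simp
qed

section \<open>Passage to the limit and the initial invariant\<close>

text \<open>\<open>norm_items\<close> and the union of the \<open>overline\<close> sets are formed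
  item by item, so both commute with the union over \<open>n\<close>.\<close>

lemma sim_limit:
  assumes "\<And>n. sim G ((f ^^ n) I) ((f' ^^ n) I')"
  shows "sim G (limit f I) (limit f' I')"
proof -
  have "norm_items (limit f' I') = (\<Union>n. norm_items ((f' ^^ n) I'))"
    by (auto simp: norm_items_def limit_def)
  also have "\<dots> = (\<Union>n. \<Union>x \<in> (f ^^ n) I. overline G x)"
    using assms by (simp add: sim_def)
  also have "\<dots> = (\<Union>x \<in> limit f I. overline G x)"
    by (auto simp: limit_def)
  finally show ?thesis
    by (simp add: sim_def)
qed

lemma sim_inv_limit:
  assumes "sim_inv G k I I'"
  shows "sim G (pella G k T I) (ella G k (unparam T) I')"
  unfolding pella_def ella_def
proof (rule sim_limit)
  fix n
  have "sim_inv G k (((scan T k \<circ> complete k \<circ> predict G k) ^^ n) I)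
      (((scan' (unparam T) k \<circ> complete' k \<circ> predict' G k) ^^ n) I')"
    by (induction n) (simp_all add: assms sim_inv_predict sim_inv_complete sim_inv_scan)
  then show "sim G (((scan T k \<circ> complete k \<circ> predict G k) ^^ n) I)
      (((scan' (unparam T) k \<circ> complete' k \<circ> predict' G k) ^^ n) I')"
    by (simp add: sim_inv_def)
qed

lemma wf_items_pitems: "I \<subseteq> pitems G D \<Longrightarrow> wf_items G I"
  by (force simp: wf_items_def pitems_def)

lemma top_closed_oitems:
  assumes "I' \<subseteq> oitems G D" "predict' G k (top_items I') \<subseteq> I'"
  shows "top_closed G k I'"
  unfolding top_closed_def
proof (intro allI impI conjI ballI)
  fix w d i j assume x: "((Top, w), d, i, j) \<in> I'"
  then have "(Top, w) \<in> irules G"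
    using assms(1) by (auto simp: oitems_def)
  \<comment> \<open>Induced rules have a \<open>Par\<close> on the left, which leaves the start
    rules, each with a single symbol on the right.\<close>
  moreover have "(Top, w) \<notin> induced G r" for r
    by (auto simp: induced_def rule_i_def rule_ii_def)
  ultimately show len: "length w = 1"
    by (auto simp: irules_def)
  fix q assume q: "d = 0" "j = k" "q \<in> irules G" "fst q = w ! 0"
  have "((Top, w), 0, i, k) \<in> top_items I'"
    using x q by (simp add: top_items_def)
  moreover have "0 < length (snd (Top :: ('p, 's) isym, w))" "snd (Top :: ('p, 's) isym, w) ! 0 = fst q"
    using len q(4) by auto
  ultimately have "(q, 0, k, k) \<in> predict' G k (top_items I')"
    unfolding in_predict'_iff using q(3) by blast
  then show "(q, 0, k, k) \<in> I'"
    using assms(2) by blast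
qed

end

theorem theorem14:
  fixes G :: "('p, 's, 'c) pgrammar"
    and D :: "'c list"
    and k :: nat
    and T :: "('p, 's, 'c) ptoken set"
    and I :: "('p, 's) pitem set"
    and I' :: "('p, 's) oitem set"
  assumes "parameterized_local_lexing G"
    and "D \<in> lists (chars G)"
    and "k \<le> length D"
    and "T \<subseteq> ptokens G D k"
    and "I \<subseteq> pitems G D"
    and "I' \<subseteq> oitems G D"
    and "predict' G k (top_items I') \<subseteq> I'"
    and "sim G I I'"
  shows "sim G (pella G k T I) (ella G k (unparam T) I')"
  using assms by (intro sim_inv_limit) (auto simp: sim_inv_def wf_items_pitems intro: top_closed_oitems)

end
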